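(* Let $\varphi$ and $\psi$ be bounded analytic functions on the open unit disc $\mathbb{U}$, and let $X$ be a nonzero bounded linear operator on $H^2$ with $XT_\varphi=T_\psi X$. If $\varphi$ singly covers some nonvoid open set $W\subset\varphi(\mathbb{U})$ and $\psi(\mathbb{U})\cap W\neq\emptyset$, then $X$ is a weighted composition operator.
   Context: $\mathbb{U}$ is the open unit disc in $\mathbb{C}$ and $H^2$ is the Hardy space of $\mathbb{U}$. For a bounded analytic function $\varphi$ on $\mathbb{U}$, $T_\varphi:H^2\to H^2$ is the analytic Toeplitz operator $T_\varphi h=\varphi h$. "$\varphi$ singly covers a set $W$" means that $\varphi$ takes some set $V\subset\mathbb{U}$ univalently (injectively) onto $W$ with $\varphi^{-1}(W)=V$, where $\varphi^{-1}(W)=\{z\in\mathbb{U}:\varphi(z)\in W\}$. A weighted composition operator on $H^2$ is an operator $C_{\omega,h}$ of the form $C_{\omega,h}f=h\cdot(f\circ\omega)$ for $f\in H^2$, where $\omega:\mathbb{U}\to\mathbb{U}$ is holomorphic and $h\in H^2$ is such that $h\cdot(f\circ\omega)\in H^2$ for every $f\in H^2$. *)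

theory Defs
  imports "HOL-Complex_Analysis.Complex_Analysis"
begin

abbreviation unit_disc :: "complex set" where
  "unit_disc \<equiv> ball 0 1"

definition circle_mean :: "(complex \<Rightarrow> complex) \<Rightarrow> real \<Rightarrow> real" where
  "circle_mean f r = (1 / (2 * pi)) * integral {0..2 * pi} (\<lambda>t. (cmod (f (of_real r * cis t)))\<^sup>2)"

text \<open>
  A function on the unit disc is represented by its extension by \<open>0\<close> to the whole plane, so that
  equality of elements of \<open>H2\<close> is equality of functions on the disc.
\<close>

definition H2 :: "(complex \<Rightarrow> complex) set" where
  "H2 = {f. f holomorphic_on unit_disc \<and> (\<forall>z. z \<notin> unit_disc \<longrightarrow> f z = 0) \<and>
            bdd_above (circle_mean f ` {0..<1})}"

definition H2_norm :: "(complex \<Rightarrow> complex) \<Rightarrow> real" where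
  "H2_norm f = sqrt (SUP r\<in>{0..<1}. circle_mean f r)"

text \<open>
  The library's \<open>bounded_linear\<close> is real-linear and needs a type as its domain; an operator on
  \<open>H2\<close> is complex-linear, and its values at functions outside \<open>H2\<close> are irrelevant.
\<close>

definition bounded_operator_H2 :: "((complex \<Rightarrow> complex) \<Rightarrow> (complex \<Rightarrow> complex)) \<Rightarrow> bool" where
  "bounded_operator_H2 X \<longleftrightarrow>
     (\<forall>f\<in>H2. X f \<in> H2) \<and>
     (\<forall>f\<in>H2. \<forall>g\<in>H2. X (\<lambda>z. f z + g z) = (\<lambda>z. X f z + X g z)) \<and>
     (\<forall>c. \<forall>f\<in>H2. X (\<lambda>z. c * f z) = (\<lambda>z. c * X f z)) \<and>
     (\<exists>K. \<forall>f\<in>H2. H2_norm (X f) \<le> K * H2_norm f)"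

text \<open>
  For \<open>f\<close> and \<open>h\<close> in \<open>H2\<close> the two products below vanish off the disc, whatever the
  values of \<open>\<phi>\<close> and \<open>\<omega>\<close> there.
\<close>

definition toeplitz :: "(complex \<Rightarrow> complex) \<Rightarrow> (complex \<Rightarrow> complex) \<Rightarrow> complex \<Rightarrow> complex" where
  "toeplitz \<phi> f = (\<lambda>z. \<phi> z * f z)"

definition weighted_comp ::
  "(complex \<Rightarrow> complex) \<Rightarrow> (complex \<Rightarrow> complex) \<Rightarrow> (complex \<Rightarrow> complex) \<Rightarrow> complex \<Rightarrow> complex" where
  "weighted_comp \<omega> h f = (\<lambda>z. h z * f (\<omega> z))"

definition is_weighted_composition_operator ::
  "((complex \<Rightarrow> complex) \<Rightarrow> (complex \<Rightarrow> complex)) \<Rightarrow> bool" where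
  "is_weighted_composition_operator X \<longleftrightarrow>
     (\<exists>\<omega> h. \<omega> holomorphic_on unit_disc \<and> \<omega> ` unit_disc \<subseteq> unit_disc \<and> h \<in> H2 \<and>
            (\<forall>f\<in>H2. weighted_comp \<omega> h f \<in> H2) \<and>
            (\<forall>f\<in>H2. X f = weighted_comp \<omega> h f))"

definition singly_covers :: "(complex \<Rightarrow> complex) \<Rightarrow> complex set \<Rightarrow> bool" where
  "singly_covers \<phi> W \<longleftrightarrow>
     (\<exists>V \<subseteq> unit_disc. inj_on \<phi> V \<and> \<phi> ` V = W \<and> {z \<in> unit_disc. \<phi> z \<in> W} = V)"

end

theory Submission
  imports Defs
begin

text \<open>
  The heart of the matter is a division property of \<open>\<phi>\<close> at values \<open>\<lambda> \<in> W\<close>. Let \<open>w\<close> be the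
  unique point of the disc with \<open>\<phi> w = \<lambda>\<close>. The inverse of \<open>\<phi>\<close> over \<open>W\<close> is continuous, so the
  preimage of a small closed disc about \<open>\<lambda>\<close> is a compact subset of the open unit disc; off this
  compact set \<open>\<phi> - \<lambda>\<close> is bounded away from zero. Since \<open>w\<close> is a simple zero, \<open>\<phi> - \<lambda>\<close> is
  \<open>z - w\<close> times a function bounded above and below, and every \<open>H2\<close> function vanishing at \<open>w\<close> is
  \<open>\<phi> - \<lambda>\<close> times an \<open>H2\<close> function (\<open>singly_covered_value_division\<close>).

  Suppose now that \<open>\<psi> z = \<lambda> \<in> W\<close>. The intertwining relation says that \<open>X ((\<phi> - \<lambda>) q)\<close> equals
  \<open>(\<psi> - \<lambda>) X q\<close>, which vanishes at \<open>z\<close>. Hence the functional \<open>f \<mapsto> X f z\<close> kills everything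
  that vanishes at \<open>w\<close>, that is, \<open>X f z = X 1 z * f w\<close> (\<open>intertwiner_local_form\<close>). So
  \<open>X f = h * (f \<circ> \<omega>)\<close>, with \<open>h = X 1\<close> and \<open>\<omega>\<close> the branch of \<open>\<phi>\<close>-inverse after \<open>\<psi>\<close>, on the
  nonempty open set where \<open>\<psi>\<close> takes values in \<open>W\<close>.

  It remains to extend \<open>\<omega>\<close> to the whole disc. Where it is defined, \<open>\<omega> = X u / X 1\<close> for the
  coordinate function \<open>u\<close>, and this quotient is meromorphic on the disc because \<open>h\<close> is not
  identically zero: otherwise \<open>X\<close> would vanish by the identity theorem. By the
  identity theorem \<open>X (u^n) = h * \<omega>^n\<close> off the zeros of \<open>h\<close>. The powers \<open>u^n\<close> have norm at
  most 1, so boundedness of \<open>X\<close> and of point evaluation (\<open>H2_pointwise_bound\<close>) keeps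
  \<open>h z * \<omega> z ^ n\<close> bounded in \<open>n\<close>, which forces \<open>\<bar>\<omega> z\<bar> \<le> 1\<close>. The singularities at the zeros of
  \<open>h\<close> are thus removable (\<open>quotient_holomorphic_extension\<close>), the maximum principle makes the
  inequality strict, and one more application of the identity theorem gives \<open>X f = h * (f \<circ> \<omega>)\<close>
  everywhere.
\<close>

section \<open>Membership and point evaluation in the Hardy space\<close>

lemma circle_point_in_disc [simp]:
  assumes "r \<in> {0..<1}"
  shows "complex_of_real r * cis t \<in> unit_disc"
  using assms by (simp add: norm_mult)

lemma continuous_on_circle_square:
  assumes "f holomorphic_on unit_disc" "r \<in> {0..<1}"
  shows "continuous_on {0..2 * pi} (\<lambda>t. (cmod (f (of_real r * cis t)))\<^sup>2)"
proof -
  have "continuous_on {0..2 * pi} (\<lambda>t. f (of_real r * cis t))"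
    by (rule continuous_on_compose2[OF holomorphic_on_imp_continuous_on[OF assms(1)]])
       (use assms(2) in \<open>auto intro!: continuous_intros simp: norm_mult\<close>)
  then show ?thesis
    by (intro continuous_intros)
qed

lemma circle_mean_le_affine:
  assumes q: "q holomorphic_on unit_disc" and f: "f holomorphic_on unit_disc"
    and r: "r \<in> {0..<1}"
    and bound: "\<And>z. z \<in> unit_disc \<Longrightarrow> (cmod (q z))\<^sup>2 \<le> A + B * (cmod (f z))\<^sup>2"
  shows "circle_mean q r \<le> A + B * circle_mean f r"
proof -
  let ?I = "\<lambda>g. integral {0..2 * pi} (\<lambda>t. (cmod (g (of_real r * cis t)))\<^sup>2)"
  have "((\<lambda>t. A + B * (cmod (f (of_real r * cis t)))\<^sup>2) has_integral (2 * pi - 0) *\<^sub>R A + B * ?I f)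
          {0..2 * pi}"
    by (intro has_integral_add has_integral_mult_right integrable_integral
          integrable_continuous_real continuous_on_circle_square[OF f r])
       (use has_integral_const_real[of A 0 "2 * pi"] in simp)
  moreover have "((\<lambda>t. (cmod (q (of_real r * cis t)))\<^sup>2) has_integral ?I q) {0..2 * pi}"
    by (intro integrable_integral integrable_continuous_real continuous_on_circle_square[OF q r])
  ultimately have "?I q \<le> 2 * pi * A + B * ?I f"
    using bound circle_point_in_disc[OF r] by (auto dest: has_integral_le)
  then show ?thesis
    unfolding circle_mean_def by (simp add: field_simps)
qed

text \<open>
  One domination criterion serves for products with bounded functions, for sums with constants and
  for quotients by functions that are bounded below only near the boundary: in the last case the
  additive constant \<open>A\<close> absorbs the behaviour on a compact set.
\<close>

lemma H2_dominated:
  assumes "q holomorphic_on unit_disc" "\<And>z. z \<notin> unit_disc \<Longrightarrow> q z = 0"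
    and f: "f \<in> H2" and "B \<ge> 0"
    and "\<And>z. z \<in> unit_disc \<Longrightarrow> (cmod (q z))\<^sup>2 \<le> A + B * (cmod (f z))\<^sup>2"
  shows "q \<in> H2"
proof -
  from f obtain M where M: "\<And>r. r \<in> {0..<1} \<Longrightarrow> circle_mean f r \<le> M"
    unfolding H2_def bdd_above_def by blast
  have "circle_mean q r \<le> A + B * M" if "r \<in> {0..<1}" for r
  proof -
    have "circle_mean q r \<le> A + B * circle_mean f r"
      using assms that by (intro circle_mean_le_affine) (auto simp: H2_def)
    also have "\<dots> \<le> A + B * M"
      using M[OF that] \<open>B \<ge> 0\<close> by (simp add: mult_left_mono)
    finally show ?thesis .
  qed
  then show ?thesis
    using assms by (auto simp: H2_def intro!: bdd_aboveI2[where M = "A + B * M"])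
qed

text \<open>
  The cut-off outside the disc is what places the monomials in \<open>H2\<close>; the constant function 1 of
  \<open>H2\<close> is \<open>disc_power 0\<close>.
\<close>

definition disc_power :: "nat \<Rightarrow> complex \<Rightarrow> complex" where
  "disc_power n z = (if z \<in> unit_disc then z ^ n else 0)"

lemma disc_power_holomorphic: "disc_power n holomorphic_on unit_disc"
  by (rule holomorphic_transform[of "\<lambda>z. z ^ n"]) (auto simp: disc_power_def intro!: holomorphic_intros)

lemma circle_mean_disc_power_le:
  assumes "r \<in> {0..<1}"
  shows "circle_mean (disc_power n) r \<le> 1"
proof -
  have "circle_mean (disc_power n) r \<le> 1 + 0 * circle_mean (disc_power n) r"
    by (rule circle_mean_le_affine[OF disc_power_holomorphic disc_power_holomorphic assms])
       (auto simp: disc_power_def norm_power power_le_one)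
  then show ?thesis by simp
qed

lemma disc_power_in_H2: "disc_power n \<in> H2"
  using circle_mean_disc_power_le
  by (auto simp: H2_def disc_power_holomorphic disc_power_def[of n] intro!: bdd_aboveI2[where M = 1])

lemma circle_mean_nonneg: "circle_mean f r \<ge> 0"
proof -
  have "integral {0..2 * pi} (\<lambda>t. (cmod (f (of_real r * cis t)))\<^sup>2) \<ge> 0"
    by (cases "(\<lambda>t. (cmod (f (of_real r * cis t)))\<^sup>2) integrable_on {0..2 * pi}")
       (auto intro: integral_nonneg simp: not_integrable_integral)
  then show ?thesis by (simp add: circle_mean_def)
qed

lemma circle_mean_le_H2_norm:
  assumes "f \<in> H2" "r \<in> {0..<1}"
  shows "circle_mean f r \<le> (H2_norm f)\<^sup>2"
proof -
  have "circle_mean f r \<le> (SUP r\<in>{0..<1}. circle_mean f r)"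
    using assms by (intro cSUP_upper) (auto simp: H2_def)
  moreover from this have "0 \<le> (SUP r\<in>{0..<1}. circle_mean f r)"
    using circle_mean_nonneg[of f r] by linarith
  ultimately show ?thesis
    by (simp add: H2_norm_def)
qed

lemma H2_norm_nonneg:
  assumes "f \<in> H2"
  shows "H2_norm f \<ge> 0"
proof -
  have "circle_mean f 0 \<le> (SUP r\<in>{0..<1}. circle_mean f r)"
    using assms by (intro cSUP_upper) (auto simp: H2_def)
  then show ?thesis
    using circle_mean_nonneg[of f 0] by (simp add: H2_norm_def)
qed

lemma H2_norm_disc_power_le: "H2_norm (disc_power n) \<le> 1"
  unfolding H2_norm_def by (simp, intro cSUP_least) (auto simp: circle_mean_disc_power_le)

text \<open>
  Applying the Cauchy formula on a circle about the origin to \<open>f\<^sup>2\<close> rather than to \<open>f\<close> produces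
  the mean square of \<open>f\<close> directly, with no appeal to the Cauchy-Schwarz inequality.
\<close>

lemma H2_pointwise_bound:
  assumes f: "f \<in> H2" and z: "z \<in> unit_disc"
  shows "(cmod (f z))\<^sup>2 \<le> 2 / (1 - cmod z) * (H2_norm f)\<^sup>2"
proof -
  have f_hol: "f holomorphic_on unit_disc" using f by (simp add: H2_def)
  define r where "r = (1 + cmod z) / 2"
  have r: "cmod z < r" "r < 1" "0 < r" "r \<in> {0..<1}"
    using z norm_ge_zero[of z] unfolding r_def by (auto simp del: norm_ge_zero)
  let ?F = "\<lambda>t. (f (0 + of_real r * cis t))\<^sup>2 / (0 + of_real r * cis t - z) * of_real r * \<i> * cis t"
  let ?c = "r / (r - cmod z)"
  let ?G = "\<lambda>t. ?c * (cmod (f (of_real r * cis t)))\<^sup>2"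
  have "((\<lambda>u. (f u)\<^sup>2 / (u - z)) has_contour_integral (2 * of_real pi * \<i> * (f z)\<^sup>2)) (circlepath 0 r)"
    using r by (intro Cauchy_integral_circlepath_simple holomorphic_intros holomorphic_on_subset[OF f_hol]) auto
  then have F: "(?F has_integral 2 * of_real pi * \<i> * (f z)\<^sup>2) {0..2 * pi}"
    unfolding circlepath_def by (subst (asm) has_contour_integral_part_circlepath_iff) auto
  have G: "?G integrable_on {0..2 * pi}"
    by (intro integrable_continuous_real continuous_intros continuous_on_circle_square[OF f_hol r(4)])
  have "cmod (?F t) \<le> ?G t" for t
  proof -
    have "r - cmod z \<le> cmod (of_real r * cis t - z)"
      using norm_triangle_ineq2[of "of_real r * cis t" z] r by (simp add: norm_mult)
    then have "(cmod (f (of_real r * cis t)))\<^sup>2 * r / cmod (of_real r * cis t - z)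
                 \<le> (cmod (f (of_real r * cis t)))\<^sup>2 * r / (r - cmod z)"
      using r by (intro divide_left_mono mult_pos_pos) auto
    then show ?thesis
      using r by (simp add: norm_mult norm_divide norm_power mult_ac)
  qed
  then have "cmod (integral {0..2 * pi} ?F) \<le> integral {0..2 * pi} ?G"
    using F G by (intro integral_norm_bound_integral) (auto simp: has_integral_integrable)
  then have "2 * pi * (cmod (f z))\<^sup>2 \<le> ?c * integral {0..2 * pi} (\<lambda>t. (cmod (f (of_real r * cis t)))\<^sup>2)"
    by (simp only: integral_unique[OF F] integral_mult_right) (simp add: norm_mult norm_power)
  then have "2 * pi * (cmod (f z))\<^sup>2 \<le> 2 * pi * (?c * circle_mean f r)"
    by (simp add: circle_mean_def)
  then have "(cmod (f z))\<^sup>2 \<le> ?c * circle_mean f r"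
    by (rule mult_left_le_imp_le) simp
  also have "\<dots> \<le> ?c * (H2_norm f)\<^sup>2"
    using r circle_mean_le_H2_norm[OF f r(4)] by (intro mult_left_mono) auto
  also have "\<dots> \<le> 2 / (1 - cmod z) * (H2_norm f)\<^sup>2"
  proof (rule mult_right_mono)
    have "r - cmod z = (1 - cmod z) / 2" by (simp add: r_def field_simps)
    then have "?c = 2 * r / (1 - cmod z)"
      by (simp only: divide_divide_eq_right mult.commute)
    also have "\<dots> \<le> 2 / (1 - cmod z)"
      using z r by (intro divide_right_mono) auto
    finally show "?c \<le> 2 / (1 - cmod z)" .
  qed simp
  finally show ?thesis .
qed

lemma H2_add_constant:
  assumes "f \<in> H2"
  shows "(\<lambda>z. f z + c * disc_power 0 z) \<in> H2"
proof (rule H2_dominated[OF _ _ assms, of _ 2 "2 * (cmod c)\<^sup>2"])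
  show "(\<lambda>z. f z + c * disc_power 0 z) holomorphic_on unit_disc"
    using assms by (intro holomorphic_intros disc_power_holomorphic) (simp add: H2_def)
  fix z :: complex
  assume "z \<in> unit_disc"
  then have "cmod (f z + c * disc_power 0 z) \<le> cmod (f z) + cmod c"
    using norm_triangle_ineq[of "f z" c] by (simp add: disc_power_def)
  then have "(cmod (f z + c * disc_power 0 z))\<^sup>2 \<le> (cmod (f z) + cmod c)\<^sup>2"
    by (intro power_mono) auto
  also have "\<dots> \<le> 2 * (cmod c)\<^sup>2 + 2 * (cmod (f z))\<^sup>2"
    using sum_squares_bound[of "cmod (f z)" "cmod c"] by (simp add: power2_sum)
  finally show "(cmod (f z + c * disc_power 0 z))\<^sup>2 \<le> 2 * (cmod c)\<^sup>2 + 2 * (cmod (f z))\<^sup>2" .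
qed (use assms in \<open>auto simp: H2_def disc_power_def\<close>)

lemma H2_cmult:
  assumes "f \<in> H2"
  shows "(\<lambda>z. c * f z) \<in> H2"
  by (rule H2_dominated[OF _ _ assms, of _ "(cmod c)\<^sup>2" 0])
     (use assms in \<open>auto simp: H2_def norm_mult power_mult_distrib intro!: holomorphic_intros\<close>)

lemma H2_toeplitz:
  assumes phi: "\<phi> holomorphic_on unit_disc" "bounded (\<phi> ` unit_disc)" and f: "f \<in> H2"
  shows "toeplitz \<phi> f \<in> H2"
proof -
  obtain M where M: "\<And>z. z \<in> unit_disc \<Longrightarrow> cmod (\<phi> z) \<le> M"
    using phi(2) unfolding bounded_iff by blast
  show ?thesis
  proof (rule H2_dominated[OF _ _ f, of _ "M\<^sup>2" 0])
    show "toeplitz \<phi> f holomorphic_on unit_disc"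
      unfolding toeplitz_def using f by (intro holomorphic_intros phi) (simp add: H2_def)
    show "(cmod (toeplitz \<phi> f z))\<^sup>2 \<le> 0 + M\<^sup>2 * (cmod (f z))\<^sup>2" if "z \<in> unit_disc" for z
      using power_mono[OF M[OF that], of 2]
      by (simp add: toeplitz_def norm_mult power_mult_distrib mult_right_mono)
  qed (use f in \<open>auto simp: toeplitz_def H2_def\<close>)
qed

section \<open>Removing the singularities of a bounded quotient\<close>

text \<open>
  The zeros of \<open>h\<close> are isolated, and near each of them the bound makes the singularity of the
  quotient removable; the bound survives the passage to the limit.
\<close>

lemma quotient_holomorphic_extension:
  assumes S: "open S" "connected S"
    and f: "f holomorphic_on S" and h: "h holomorphic_on S"
    and nz: "\<exists>z\<in>S. h z \<noteq> 0"
    and le: "\<And>z. z \<in> S \<Longrightarrow> h z \<noteq> 0 \<Longrightarrow> cmod (f z / h z) \<le> C"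
  obtains q where "q holomorphic_on S" "\<And>z. z \<in> S \<Longrightarrow> h z \<noteq> 0 \<Longrightarrow> q z = f z / h z"
    "\<And>z. z \<in> S \<Longrightarrow> cmod (q z) \<le> C"
proof
  let ?F = "\<lambda>z. f z / h z"
  have analytic: "?F analytic_on {z}" if "z \<in> S" "h z \<noteq> 0" for z
    using that f h S(1) by (intro analytic_on_divide) (auto simp: analytic_at)
  show "remove_sings ?F z = f z / h z" if "z \<in> S" "h z \<noteq> 0" for z
    using analytic[OF that] by simp
  have extension: "remove_sings ?F analytic_on {z} \<and> cmod (remove_sings ?F z) \<le> C" if z: "z \<in> S" for z
  proof (cases "h z = 0")
    case False
    then show ?thesis
      using analytic[OF z] le[OF z] by (simp add: remove_sings_analytic_on)
  next
    case True
    from nz obtain b where "b \<in> S" "h b \<noteq> 0" by blast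
    then obtain r where r: "0 < r" "ball z r \<subseteq> S" "\<And>u. u \<in> ball z r - {z} \<Longrightarrow> h u \<noteq> 0"
      using isolated_zeros[OF h S z True, of b] by blast
    have hol: "?F holomorphic_on ball z r - {z}"
      using r by (intro holomorphic_intros holomorphic_on_subset[OF f] holomorphic_on_subset[OF h]) auto
    have ev: "\<forall>\<^sub>F u in at z. cmod (?F u) \<le> C"
      using eventually_at_ball'[OF r(1), of z UNIV] by eventually_elim (use r le in auto)
    have "\<exists>g. g holomorphic_on ball z r \<and> (\<forall>u\<in>ball z r - {z}. g u = ?F u)"
      by (subst holomorphic_on_extend_bounded[OF hol]) (use r(1) ev in auto)
    then obtain g where g: "g holomorphic_on ball z r" "\<And>u. u \<in> ball z r - {z} \<Longrightarrow> g u = ?F u"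
      by blast
    have "g \<midarrow>z\<rightarrow> g z"
      using g(1) r(1) by (metis centre_in_ball continuous_on_eq_continuous_at holomorphic_on_imp_continuous_on
          isCont_def open_ball)
    then have lim: "?F \<midarrow>z\<rightarrow> g z"
      by (rule Lim_transform_within_open[of _ _ _ _ "ball z r"]) (use g(2) r(1) in auto)
    moreover have "isolated_singularity_at ?F z"
      using hol r(1) by (auto simp: isolated_singularity_at_def analytic_on_open open_delete intro!: exI[of _ r])
    ultimately have "remove_sings ?F analytic_on {z}"
      by (intro remove_sings_analytic_at)
    moreover have "cmod (g z) \<le> C"
      using Lim_norm_ubound[OF _ lim ev] by simp
    ultimately show ?thesis
      using remove_sings_eqI[OF lim] by simp
  qed
  then show "remove_sings ?F holomorphic_on S"
    by (metis analytic_imp_holomorphic analytic_on_analytic_at)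
  show "cmod (remove_sings ?F z) \<le> C" if "z \<in> S" for z
    using extension[OF that] by simp
qed

section \<open>Division by a singly covered value\<close>

text \<open>
  In terms of inner-outer factorization, for bounded \<open>\<phi>\<close>: \<open>\<phi> - \<phi> w\<close> has no singular inner factor and its outer
  factor is invertible, because all \<open>\<phi>\<close>-preimages of a neighbourhood of \<open>\<phi> w\<close> stay in a compact
  part of the disc. This is where openness of \<open>W\<close> enters; for a single value with a single
  preimage the conclusion may fail.
\<close>

lemma singly_covered_value_division:
  assumes phi: "\<phi> holomorphic_on unit_disc"
    and W: "open W" and V: "V = {z \<in> unit_disc. \<phi> z \<in> W}"
    and inj: "inj_on \<phi> V" and onto: "\<phi> ` V = W"
    and w: "w \<in> V"
    and p: "p \<in> H2" "p w = 0"
  obtains q where "q \<in> H2" "p = (\<lambda>z. (\<phi> z - \<phi> w) * q z)"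
proof -
  have "openin (top_of_set unit_disc) (unit_disc \<inter> \<phi> -` W)"
    using phi W by (intro continuous_openin_preimage_gen holomorphic_on_imp_continuous_on)
  moreover have "unit_disc \<inter> \<phi> -` W = V" using V by auto
  ultimately have open_V: "open V" by (simp add: openin_open_eq)
  have V_sub: "V \<subseteq> unit_disc" using V by auto
  with w have w_disc: "w \<in> unit_disc" by auto
  have phi_V: "\<phi> holomorphic_on V" using holomorphic_on_subset[OF phi V_sub] .
  have p_hol: "p holomorphic_on unit_disc" using p by (simp add: H2_def)
  obtain g where g: "g holomorphic_on W" "\<And>z. z \<in> V \<Longrightarrow> g (\<phi> z) = z"
    using holomorphic_has_inverse[OF phi_V open_V inj] onto by metis
  have "\<phi> w \<in> W" using w onto by auto
  then obtain \<epsilon> where eps: "\<epsilon> > 0" "cball (\<phi> w) \<epsilon> \<subseteq> W"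
    using W open_contains_cball by blast
  define K where "K = g ` cball (\<phi> w) \<epsilon>"
  have "compact K"
    unfolding K_def
    by (intro compact_continuous_image continuous_on_subset[OF holomorphic_on_imp_continuous_on[OF g(1)]] eps)
       auto
  have K_disc: "K \<subseteq> unit_disc"
    unfolding K_def using eps(2) onto g(2) V_sub by fastforce
  have far: "\<epsilon> < cmod (\<phi> z - \<phi> w)" if "z \<in> unit_disc" "z \<notin> K" for z
  proof (rule ccontr)
    assume "\<not> ?thesis"
    then have "\<phi> z \<in> cball (\<phi> w) \<epsilon>" by (simp add: dist_norm norm_minus_commute)
    moreover from this have "z \<in> V" using eps that V by auto
    ultimately have "z \<in> K" using g(2) unfolding K_def by (metis image_eqI)
    with that show False by simp
  qed
  have only_zero: "z = w" if "z \<in> unit_disc" "\<phi> z = \<phi> w" for z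
    using that w V inj by (auto dest: inj_onD)
  \<comment> \<open>Both numerator and denominator of \<open>p / (\<phi> - \<phi> w)\<close> are divided by \<open>z - w\<close> before forming
    the quotient; the zero of \<open>\<phi> - \<phi> w\<close> is simple, so the new denominator never vanishes.\<close>
  let ?D = "\<lambda>z. if z = w then deriv \<phi> w else (\<phi> z - \<phi> w) / (z - w)"
  let ?P = "\<lambda>z. if z = w then deriv p w else (p z - p w) / (z - w)"
  define q where "q = (\<lambda>z. if z \<in> unit_disc then ?P z / ?D z else 0)"
  have D: "?D holomorphic_on unit_disc" and P: "?P holomorphic_on unit_disc"
    using pole_lemma_open[OF phi open_ball, of w] pole_lemma_open[OF p_hol open_ball, of w] by auto
  have "deriv \<phi> w \<noteq> 0"
    by (rule holomorphic_injective_imp_regular[OF phi_V open_V inj w])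
  then have "?D z \<noteq> 0" if "z \<in> unit_disc" for z
    using only_zero[OF that] by auto
  then have "(\<lambda>z. ?P z / ?D z) holomorphic_on unit_disc"
    by (intro holomorphic_on_divide D P)
  then have q_hol: "q holomorphic_on unit_disc"
    by (rule holomorphic_transform) (simp add: q_def)
  have p_eq: "p z = (\<phi> z - \<phi> w) * q z" for z
    using only_zero[of z] p w_disc by (auto simp: q_def H2_def)
  have "compact (q ` K)"
    by (intro compact_continuous_image \<open>compact K\<close> continuous_on_subset[OF holomorphic_on_imp_continuous_on[OF q_hol] K_disc])
  then obtain M where M: "\<And>z. z \<in> K \<Longrightarrow> cmod (q z) \<le> M"
    by (meson compact_imp_bounded bounded_iff image_eqI)
  have bound: "(cmod (q z))\<^sup>2 \<le> M\<^sup>2 + 1 / \<epsilon>\<^sup>2 * (cmod (p z))\<^sup>2" if z: "z \<in> unit_disc" for z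
  proof (cases "z \<in> K")
    case True
    then have "(cmod (q z))\<^sup>2 \<le> M\<^sup>2" using M by (intro power_mono) auto
    then show ?thesis by (simp add: add_increasing2)
  next
    case False
    then have "\<epsilon> * cmod (q z) \<le> cmod (p z)"
      using far[OF z] by (simp add: p_eq norm_mult mult_right_mono)
    then have "(\<epsilon> * cmod (q z))\<^sup>2 \<le> (cmod (p z))\<^sup>2" 
      using eps by (intro power_mono) auto
    then have "(cmod (q z))\<^sup>2 \<le> 1 / \<epsilon>\<^sup>2 * (cmod (p z))\<^sup>2"
      using eps by (simp add: field_simps power_mult_distrib)
    then show ?thesis by (simp add: add_increasing)
  qed
  have "q \<in> H2"
    by (rule H2_dominated[OF q_hol _ p(1) _ bound]) (auto simp: q_def)
  then show thesis using p_eq that by blast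
qed

section \<open>The intertwining operator\<close>

text \<open>
  The function \<open>f - f w\<close> is \<open>\<phi> - \<psi> z\<close> times some \<open>q\<close> in \<open>H2\<close>, and \<open>X\<close> turns this factor into
  \<open>\<psi> - \<psi> z\<close>, which is zero at \<open>z\<close>.
\<close>

lemma intertwiner_local_form:
  assumes phi: "\<phi> holomorphic_on unit_disc" "bounded (\<phi> ` unit_disc)"
    and X: "bounded_operator_H2 X"
    and intertwines: "\<forall>f\<in>H2. X (toeplitz \<phi> f) = toeplitz \<psi> (X f)"
    and W: "open W" and V: "V = {z \<in> unit_disc. \<phi> z \<in> W}"
    and inj: "inj_on \<phi> V" and onto: "\<phi> ` V = W"
    and w: "w \<in> V" "\<phi> w = \<psi> z"
    and f: "f \<in> H2"
  shows "X f z = X (disc_power 0) z * f w"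
proof -
  have w_disc: "w \<in> unit_disc" using w V by simp
  have X_add: "X (\<lambda>z. f z + g z) = (\<lambda>z. X f z + X g z)" if "f \<in> H2" "g \<in> H2" for f g
    using X that by (simp add: bounded_operator_H2_def)
  have X_cmult: "X (\<lambda>z. c * f z) = (\<lambda>z. c * X f z)" if "f \<in> H2" for c f
    using X that by (simp add: bounded_operator_H2_def)
  define p where "p = (\<lambda>u. f u + (- f w) * disc_power 0 u)"
  have "p \<in> H2" "p w = 0"
    using H2_add_constant[OF f, of "- f w"] w_disc by (auto simp: p_def disc_power_def)
  then obtain q where q: "q \<in> H2" "p = (\<lambda>u. (\<phi> u - \<phi> w) * q u)"
    using singly_covered_value_division[OF phi(1) W V inj onto w(1)] by blast
  have "p = (\<lambda>u. toeplitz \<phi> q u + (- \<phi> w) * q u)"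
    by (simp add: q(2) toeplitz_def algebra_simps)
  then have "X p z = X (toeplitz \<phi> q) z + (- \<phi> w) * X q z"
    using X_add[OF H2_toeplitz[OF phi q(1)] H2_cmult[OF q(1)]] X_cmult[OF q(1)] by metis
  also have "\<dots> = 0"
    using intertwines q(1) w(2) by (simp add: toeplitz_def)
  finally have "X p z = 0" .
  moreover have "X p z = X f z + (- f w) * X (disc_power 0) z"
    unfolding p_def X_add[OF f H2_cmult[OF disc_power_in_H2]] X_cmult[OF disc_power_in_H2] ..
  ultimately show ?thesis by (simp add: algebra_simps)
qed

lemma bounded_multiples_of_powers:
  fixes c a :: real
  assumes "c > 0" and bound: "\<And>n. c * a ^ n \<le> B"
  shows "a \<le> 1"
proof (rule ccontr)
  assume "\<not> a \<le> 1"
  then obtain n where "B / c < a ^ n" using real_arch_pow[of a "B / c"] by auto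
  then show False using bound[of n] \<open>c > 0\<close> by (simp add: field_simps)
qed

theorem mainTheorem6:
  fixes \<phi> \<psi> :: "complex \<Rightarrow> complex"
    and X :: "(complex \<Rightarrow> complex) \<Rightarrow> (complex \<Rightarrow> complex)"
    and W :: "complex set"
  assumes "\<phi> holomorphic_on unit_disc" and "bounded (\<phi> ` unit_disc)"
    and "\<psi> holomorphic_on unit_disc" and "bounded (\<psi> ` unit_disc)"
    and "bounded_operator_H2 X"
    and "\<exists>f\<in>H2. X f \<noteq> (\<lambda>z. 0)"
    and "\<forall>f\<in>H2. X (toeplitz \<phi> f) = toeplitz \<psi> (X f)"
    and "open W" and "W \<noteq> {}" and "W \<subseteq> \<phi> ` unit_disc"
    and "singly_covers \<phi> W"
    and "\<psi> ` unit_disc \<inter> W \<noteq> {}"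
  shows "is_weighted_composition_operator X"
proof -
  define V where "V = {z \<in> unit_disc. \<phi> z \<in> W}"
  have V: "inj_on \<phi> V" "\<phi> ` V = W" "V \<subseteq> unit_disc"
    using assms(11) unfolding singly_covers_def V_def by auto
  define D where "D = unit_disc \<inter> \<psi> -` W"
  have D: "open D" "D \<noteq> {}" "D \<subseteq> unit_disc"
    using continuous_openin_preimage_gen[OF holomorphic_on_imp_continuous_on[OF assms(3)] assms(8)] assms(12)
    by (auto simp: D_def openin_open_eq)
  define \<omega>\<^sub>0 where "\<omega>\<^sub>0 = (\<lambda>z. inv_into V \<phi> (\<psi> z))"
  have \<omega>\<^sub>0: "\<omega>\<^sub>0 z \<in> V" "\<phi> (\<omega>\<^sub>0 z) = \<psi> z" if "z \<in> D" for z
    using that V(2) by (auto simp: \<omega>\<^sub>0_def D_def inv_into_into f_inv_into_f)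
  have in_disc: "\<omega>\<^sub>0 z \<in> unit_disc" if "z \<in> D" for z
    using \<omega>\<^sub>0(1)[OF that] V(3) by blast
  define h where "h = X (disc_power 0)"
  have local_form: "X f z = h z * f (\<omega>\<^sub>0 z)" if "z \<in> D" "f \<in> H2" for f z
    unfolding h_def
    by (rule intertwiner_local_form[OF assms(1,2,5,7,8) V_def V(1,2) \<omega>\<^sub>0[OF that(1)] that(2)])
  have X_H2: "X f \<in> H2" if "f \<in> H2" for f
    using assms(5) that by (simp add: bounded_operator_H2_def)
  have X_hol: "X f holomorphic_on unit_disc" and X_off: "z \<notin> unit_disc \<Longrightarrow> X f z = 0"
    if "f \<in> H2" for f z
    using X_H2[OF that] by (auto simp: H2_def)
  have h: "h \<in> H2" "h holomorphic_on unit_disc"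
    unfolding h_def by (intro X_H2 X_hol disc_power_in_H2)+
  have continuation: "f z = g z"
    if "open E" "E \<noteq> {}" "E \<subseteq> unit_disc" "f holomorphic_on unit_disc" "g holomorphic_on unit_disc"
      "\<And>z. z \<in> E \<Longrightarrow> f z = g z" "z \<in> unit_disc" for E f g z
    using analytic_continuation_open[OF that(1) open_ball that(2) _ that(3-6) that(7)] by simp
  have "\<exists>z\<in>D. h z \<noteq> 0"
  proof (rule ccontr)
    assume h0: "\<not> (\<exists>z\<in>D. h z \<noteq> 0)"
    have "X f z = 0" if "f \<in> H2" for f z
    proof (cases "z \<in> unit_disc")
      case True
      then show ?thesis
        using continuation[OF D X_hol[OF that], of "\<lambda>_. 0"] local_form[OF _ that] h0 by auto
    qed (rule X_off[OF that])
    then show False using assms(6) by auto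
  qed
  then obtain z\<^sub>1 where z\<^sub>1: "z\<^sub>1 \<in> D" "h z\<^sub>1 \<noteq> 0" by blast
  \<comment> \<open>This is \<open>X (u^n) = h * (X u / h)^n\<close> cleared of denominators, so that the identity theorem
    applies on the whole disc although the zeros of \<open>h\<close> have not been dealt with yet.\<close>
  have pow: "X (disc_power n) z * h z ^ n = X (disc_power 1) z ^ n * h z" if "z \<in> unit_disc" for n z
  proof (rule continuation[OF D _ _ _ that])
    fix z assume "z \<in> D"
    then show "X (disc_power n) z * h z ^ n = X (disc_power 1) z ^ n * h z"
      using in_disc by (simp add: local_form disc_power_in_H2 disc_power_def power_mult_distrib)
  qed (intro holomorphic_intros X_hol disc_power_in_H2 h)+
  obtain K where K: "\<And>f. f \<in> H2 \<Longrightarrow> H2_norm (X f) \<le> K * H2_norm f"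
    using assms(5) unfolding bounded_operator_H2_def by blast
  have norm_X_pow: "(H2_norm (X (disc_power n)))\<^sup>2 \<le> K\<^sup>2" for n
  proof -
    have "H2_norm (X (disc_power n)) \<le> \<bar>K * H2_norm (disc_power n)\<bar>"
      using K[OF disc_power_in_H2, of n] by linarith
    also have "\<dots> \<le> \<bar>K\<bar>"
      using H2_norm_disc_power_le[of n] H2_norm_nonneg[OF disc_power_in_H2, of n]
      by (simp add: abs_mult mult_left_le)
    finally have "(H2_norm (X (disc_power n)))\<^sup>2 \<le> \<bar>K\<bar>\<^sup>2"
      by (intro power_mono H2_norm_nonneg X_H2 disc_power_in_H2)
    then show ?thesis by simp
  qed
  have quot_le: "cmod (X (disc_power 1) z / h z) \<le> 1" if z: "z \<in> unit_disc" "h z \<noteq> 0" for z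
  proof -
    let ?a = "cmod (X (disc_power 1) z / h z)"
    have "(cmod (h z))\<^sup>2 * (?a\<^sup>2) ^ n \<le> 2 / (1 - cmod z) * K\<^sup>2" for n
    proof -
      have "X (disc_power n) z = h z * (X (disc_power 1) z / h z) ^ n"
        using pow[OF z(1), of n] z(2) by (simp add: field_simps)
      then have "(cmod (h z))\<^sup>2 * (?a\<^sup>2) ^ n = (cmod (X (disc_power n) z))\<^sup>2"
        by (simp add: norm_mult norm_power power_mult_distrib power_mult[symmetric] mult.commute)
      also have "\<dots> \<le> 2 / (1 - cmod z) * (H2_norm (X (disc_power n)))\<^sup>2"
        by (intro H2_pointwise_bound X_H2 disc_power_in_H2 z)
      also have "\<dots> \<le> 2 / (1 - cmod z) * K\<^sup>2"
        using z by (intro mult_left_mono norm_X_pow) auto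
      finally show ?thesis .
    qed
    then have "?a\<^sup>2 \<le> 1"
      using z(2) by (intro bounded_multiples_of_powers[of "(cmod (h z))\<^sup>2"]) auto
    then show ?thesis by (simp only: abs_norm_cancel abs_square_le_1)
  qed
  obtain \<omega> where \<omega>: "\<omega> holomorphic_on unit_disc"
      "\<And>z. z \<in> unit_disc \<Longrightarrow> h z \<noteq> 0 \<Longrightarrow> \<omega> z = X (disc_power 1) z / h z"
      "\<And>z. z \<in> unit_disc \<Longrightarrow> cmod (\<omega> z) \<le> 1"
    using quotient_holomorphic_extension[OF open_ball _ X_hol[OF disc_power_in_H2, of 1] h(2) _ quot_le]
      z\<^sub>1 D(3) connected_ball by blast
  \<comment> \<open>On \<open>D\<close> the extension \<open>\<omega>\<close> is known to be the given branch only off the zeros of \<open>h\<close>.\<close>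
  define E where "E = D \<inter> h -` (- {0})"
  have "open E"
    unfolding E_def using D holomorphic_on_imp_continuous_on[OF h(2)]
    by (intro continuous_open_preimage) (auto intro: continuous_on_subset)
  have E: "E \<noteq> {}" "E \<subseteq> unit_disc" "E \<subseteq> D" using z\<^sub>1 D(3) by (auto simp: E_def)
  have \<omega>_E: "\<omega> z = \<omega>\<^sub>0 z" if "z \<in> E" for z
    using that E(2,3) in_disc[of z] local_form[OF _ disc_power_in_H2, of z 1] \<omega>(2)[of z]
    by (auto simp: E_def disc_power_def)
  have \<omega>_disc: "\<omega> z \<in> unit_disc" if z: "z \<in> unit_disc" for z
  proof (rule ccontr)
    assume "\<not> ?thesis"
    then have "cmod (\<omega> z) = 1" using \<omega>(3)[OF z] by simp
    then have "\<omega> constant_on unit_disc"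
      using maximum_modulus_principle[OF \<omega>(1) open_ball _ open_ball order_refl z] \<omega>(3) by simp
    moreover have "z\<^sub>1 \<in> E" using z\<^sub>1 by (simp add: E_def)
    ultimately have "\<omega> z = \<omega>\<^sub>0 z\<^sub>1"
      using \<omega>_E z E(2) by (metis constant_on_def subsetD)
    then show False using in_disc[OF z\<^sub>1(1)] \<open>cmod (\<omega> z) = 1\<close> by simp
  qed
  have X_eq: "X f z = weighted_comp \<omega> h f z" if f: "f \<in> H2" for f z
  proof (cases "z \<in> unit_disc")
    case True
    have f_hol: "f holomorphic_on unit_disc" using f by (simp add: H2_def)
    have "(\<lambda>z. f (\<omega> z)) holomorphic_on unit_disc"
      using holomorphic_on_compose_gen[OF \<omega>(1) f_hol] \<omega>_disc unfolding o_def by blast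
    then have "weighted_comp \<omega> h f holomorphic_on unit_disc"
      unfolding weighted_comp_def by (intro holomorphic_intros h)
    then show ?thesis
    proof (rule continuation[OF \<open>open E\<close> E(1,2) X_hol[OF f] _ _ True])
      fix u assume "u \<in> E"
      then show "X f u = weighted_comp \<omega> h f u"
        using local_form[OF _ f, of u] \<omega>_E[of u] E(3) by (auto simp: weighted_comp_def)
    qed
  next
    case False
    then show ?thesis using X_off[OF f] h(1) by (simp add: weighted_comp_def H2_def)
  qed
  then have "X f = weighted_comp \<omega> h f" if "f \<in> H2" for f using that by blast
  then show ?thesis
    unfolding is_weighted_composition_operator_def
    using \<omega>(1) \<omega>_disc h(1) X_H2 by (metis image_subsetI)
qed

end
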